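(* Let $d\ge 1$ be an integer and let $\mathbf{X}\subset\mathbb{R}^d$ be a spatial Poisson cluster process with immigrant intensity $\nu\in(0,\infty)$ and cluster radius $L$. Let $e(r)=1-P(N_{\mathbf{X}}(b(0,r))=0)$, $r>0$, be its empty space function. Assume $\mathrm{E}[L^d]<\infty$. Then $$\lim_{r\to\infty}\frac{1}{\omega_d(r)}\log\log\left(e(r)^{-1}\right)=-\nu.$$
   Context: Spatial Poisson cluster process. The immigrants (cluster centers) are the points $\{X_i\}$ of a homogeneous Poisson process $I\subset\mathbb{R}^d$ with intensity $\nu\in(0,\infty)$. Each immigrant $X_i\in I$ generates a cluster $C_i=C_{X_i}$, a finite point process in $\mathbb{R}^d$ containing $X_i$. Given $I$, the centered clusters $C_{X_i}-X_i=\{Y-X_i:Y\in C_{X_i}\}$ are independent, identically distributed, and independent of $I$. $\mathbf{X}$ is the union of all clusters. $C_0$ denotes the cluster generated by a point at $0$ (i.e. a point process with the common law of the centered clusters); the number $S$ of points in $C_0$ satisfies the standing assumption $\mathrm{E}[S]<\infty$; $L=\sup_{Y\in C_0}\|Y\|$ is the radius of $C_0$ ($\|\cdot\|$ the Euclidean norm). $b(0,r)$ is the Euclidean ball of radius $r$ centered at $0$, $N_{\mathbf{X}}(b(0,r))$ is the number of points of $\mathbf{X}$ in $b(0,r)$, and $\omega_d(r)=r^d\pi^{d/2}/\Gamma(1+d/2)$ is the volume of $b(0,r)$. The empty space function is the distribution function of the distance from the origin to the nearest point of $\mathbf{X}$. *)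

theory Defs
  imports "HOL-Probability.Probability"
begin

(* Point processes are counted with multiplicity. A locally finite infinite process is given by
   an enumeration of its points by nat; a finite one is a random multiset. *)

definition num_pts :: "(nat \<Rightarrow> 'w \<Rightarrow> 'a) \<Rightarrow> 'a set \<Rightarrow> 'w \<Rightarrow> ennreal" where
  "num_pts X A \<omega> = (\<Sum>i. indicator A (X i \<omega>))"

definition mset_num :: "'a set \<Rightarrow> 'a multiset \<Rightarrow> nat" where
  "mset_num A m = size (filter_mset (\<lambda>y. y \<in> A) m)"

(* The usual sigma-algebra on finite configurations: the smallest one that makes the number of
   points in each Borel set measurable. *)
definition mset_space :: "'a::euclidean_space multiset measure" where
  "mset_space = sigma UNIV {{m. mset_num A m = k} | A k. A \<in> sets borel}"

(* There is no separate local finiteness assumption: the probabilities in num_poisson add up to 1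
   over k, so bounded sets almost surely contain finitely many points. Since nu > 0 the process
   almost surely has infinitely many points, so an enumeration by all of nat loses nothing. *)
locale homogeneous_poisson_process = prob_space M
  for M :: "'w measure" +
  fixes \<nu> :: real and X :: "nat \<Rightarrow> 'w \<Rightarrow> 'a::euclidean_space"
  assumes intensity_pos: "0 < \<nu>"
    and points_measurable: "\<And>i. X i \<in> measurable M borel"
    and num_poisson: "\<And>A k. A \<in> sets borel \<Longrightarrow> bounded A \<Longrightarrow>
      prob {\<omega> \<in> space M. num_pts X A \<omega> = of_nat k} =
        exp (- (\<nu> * measure lborel A)) * (\<nu> * measure lborel A) ^ k / fact k"
    and num_indep: "\<And>(J :: nat set) A. finite J \<Longrightarrow>
      (\<And>j. j \<in> J \<Longrightarrow> A j \<in> sets borel \<and> bounded (A j)) \<Longrightarrow> disjoint_family_on A J \<Longrightarrow>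
      indep_vars (\<lambda>_. borel) (\<lambda>j. num_pts X (A j)) J"

definition centered :: "(nat \<Rightarrow> 'w \<Rightarrow> 'a::euclidean_space) \<Rightarrow> (nat \<Rightarrow> 'w \<Rightarrow> 'a multiset) \<Rightarrow>
    nat \<Rightarrow> 'w \<Rightarrow> 'a multiset" where
  "centered X C i \<omega> = image_mset (\<lambda>y. y - X i \<omega>) (C i \<omega>)"

(* X i is the i-th immigrant, C i its cluster, and Q the common law of the centered clusters,
   that is, the law of the cluster of a point at 0. Independence of the immigrant process is
   independence of the whole enumeration X: if it were only required of the counts, the order of
   the points could depend on the clusters. *)
locale spatial_poisson_cluster_process = homogeneous_poisson_process M \<nu> X
  for M :: "'w measure" and \<nu> :: real and X :: "nat \<Rightarrow> 'w \<Rightarrow> 'a::euclidean_space" +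
  fixes C :: "nat \<Rightarrow> 'w \<Rightarrow> 'a multiset" and Q :: "'a multiset measure"
  assumes clusters_measurable: "\<And>i. C i \<in> measurable M mset_space"
    and immigrant_in_cluster: "\<And>i. AE \<omega> in M. X i \<omega> \<in># C i \<omega>"
    and centered_indep: "indep_vars (\<lambda>_. mset_space) (centered X C) UNIV"
    and centered_law: "\<And>i. distr M mset_space (centered X C i) = Q"
    and centered_indep_immigrants: "indep_set
      (sets (vimage_algebra (space M) (\<lambda>\<omega> i. X i \<omega>) (PiM UNIV (\<lambda>_. borel))))
      (sets (vimage_algebra (space M) (\<lambda>\<omega> i. centered X C i \<omega>) (PiM UNIV (\<lambda>_. mset_space))))"

(* Number of points in A of the union (superposition) of all clusters. *)
definition cluster_num :: "(nat \<Rightarrow> 'w \<Rightarrow> 'a multiset) \<Rightarrow> 'a set \<Rightarrow> 'w \<Rightarrow> ennreal" where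
  "cluster_num C A \<omega> = (\<Sum>i. of_nat (mset_num A (C i \<omega>)))"

definition cluster_radius :: "'a::euclidean_space multiset \<Rightarrow> real" where
  "cluster_radius m = (SUP y\<in>set_mset m. norm y)"

(* The ball is closed, so that this is the distribution function P(distance <= r) of the distance
   from the origin to the nearest point. *)
definition empty_space_function ::
    "'w measure \<Rightarrow> (nat \<Rightarrow> 'w \<Rightarrow> 'a::euclidean_space multiset) \<Rightarrow> real \<Rightarrow> real" where
  "empty_space_function M C r =
     1 - measure M {\<omega> \<in> space M. cluster_num C (cball 0 r) \<omega> = 0}"

definition ball_volume :: "nat \<Rightarrow> real \<Rightarrow> real" where
  "ball_volume d r = r ^ d * pi powr (real d / 2) / Gamma (1 + real d / 2)"

end

(* The void probability p(r) of the ball of radius r satisfies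
     exp (- nu E[vol b(0, r + 1 + L)]) <= p(r) <= exp (- nu vol b(0, r)).
   The upper bound holds because immigrants belong to their clusters; the lower bound is the void
   probability of the thinned Poisson process of those immigrants whose cluster is large enough to
   reach the ball. The moment of order d of L makes the two volumes asymptotically equal, and
   - ln (1 - p) lies between p and 2 p for small p. *)

theory Submission
  imports Defs
begin

section \<open>Counts of points and joint laws\<close>

text \<open>A series of indicators over \<open>nat\<close> is an integral against counting measure
  on the indices. An infinite index set thus has count infinity, and repeated points keep their
  multiplicity.\<close>

lemma num_pts_eq_emeasure: "num_pts X A \<omega> = emeasure (count_space UNIV) {i. X i \<omega> \<in> A}"
proof -
  have "num_pts X A \<omega> = (\<Sum>i. indicator {i. X i \<omega> \<in> A} i)"
    unfolding num_pts_def by (simp add: indicator_def)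
  also have "\<dots> = (\<integral>\<^sup>+i. indicator {i. X i \<omega> \<in> A} i \<partial>count_space UNIV)"
    by (rule nn_integral_count_space_nat[symmetric])
  finally show ?thesis by simp
qed

lemma num_pts_eq_card:
  assumes "finite {i. X i \<omega> \<in> A}"
  shows "num_pts X A \<omega> = of_nat (card {i. X i \<omega> \<in> A})"
  using assms by (simp add: num_pts_eq_emeasure)

lemma num_pts_eq_of_nat_iff:
  "num_pts X A \<omega> = of_nat k \<longleftrightarrow> finite {i. X i \<omega> \<in> A} \<and> card {i. X i \<omega> \<in> A} = k"
  by (cases "finite {i. X i \<omega> \<in> A}") (simp_all add: num_pts_eq_emeasure)

lemma space_mset_space [simp]: "space mset_space = UNIV"
  by (simp add: mset_space_def space_measure_of_conv)

lemma sets_mset_num_eq [measurable]: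
  assumes "A \<in> sets borel"
  shows "{m. mset_num A m = k} \<in> sets mset_space"
  unfolding mset_space_def using assms by (subst sets_measure_of) auto

lemma mset_num_eq_0_iff: "mset_num A m = 0 \<longleftrightarrow> (\<forall>y\<in>#m. y \<notin> A)"
  by (auto simp: mset_num_def filter_mset_eq_conv)

lemma cluster_num_eq_0_iff: "cluster_num C A \<omega> = 0 \<longleftrightarrow> (\<forall>i. \<forall>y\<in>#C i \<omega>. y \<notin> A)"
  unfolding cluster_num_def by (subst suminf_eq_zero_iff) (auto simp: mset_num_eq_0_iff)

text \<open>Both measures agree on rectangles, which determines them. This turns independence of
  generated sigma-algebras into a product law, so that Fubini applies to the pair of immigrants and
  centered clusters.\<close>

lemma (in prob_space) distr_pair_indep_set:
  assumes f: "f \<in> measurable M S" and g: "g \<in> measurable M T"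
    and indep: "indep_set (sets (vimage_algebra (space M) f S)) (sets (vimage_algebra (space M) g T))"
  shows "distr M (S \<Otimes>\<^sub>M T) (\<lambda>\<omega>. (f \<omega>, g \<omega>)) = distr M S f \<Otimes>\<^sub>M distr M T g"
proof (rule sym, rule pair_measure_eqI)
  show "sigma_finite_measure (distr M S f)" "sigma_finite_measure (distr M T g)"
    by (intro prob_space_imp_sigma_finite prob_space_distr f g)+
  fix A B assume "A \<in> sets (distr M S f)" "B \<in> sets (distr M T g)"
  then have AB: "A \<in> sets S" "B \<in> sets T" by simp_all
  have "prob ((f -` A \<inter> space M) \<inter> (g -` B \<inter> space M)) =
      prob (f -` A \<inter> space M) * prob (g -` B \<inter> space M)"
    using AB by (intro indep_setD[OF indep] in_vimage_algebra)
  moreover have "(f -` A \<inter> space M) \<inter> (g -` B \<inter> space M) =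
      (\<lambda>\<omega>. (f \<omega>, g \<omega>)) -` (A \<times> B) \<inter> space M"
    by auto
  ultimately show "emeasure (distr M S f) A * emeasure (distr M T g) B =
      emeasure (distr M (S \<Otimes>\<^sub>M T) (\<lambda>\<omega>. (f \<omega>, g \<omega>))) (A \<times> B)"
    using f g AB by (simp add: emeasure_distr emeasure_eq_measure ennreal_mult)
qed simp

section \<open>Generating functions of the Poisson counts\<close>

context homogeneous_poisson_process
begin

lemma num_pts_measurable:
  assumes A: "A \<in> sets borel"
  shows "num_pts X A \<in> borel_measurable M"
proof -
  note [measurable] = points_measurable A
  show ?thesis unfolding num_pts_def[abs_def] by measurable
qed

text \<open>The Poisson weights add up to 1, so almost surely the count is a natural number and not
  infinity.\<close>

lemma AE_finite_points:
  assumes A: "A \<in> sets borel" "bounded A"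
  shows "AE \<omega> in M. finite {i. X i \<omega> \<in> A}"
proof -
  note [measurable] = num_pts_measurable[OF A(1)]
  let ?B = "\<lambda>k. {\<omega> \<in> space M. num_pts X A \<omega> = of_nat k}"
  define l where "l = \<nu> * measure lborel A"
  have B: "range ?B \<subseteq> events" by auto
  have "(\<lambda>k. prob (?B k)) sums prob (\<Union>k. ?B k)"
    using B by (rule finite_measure_UNION) (auto simp: disjoint_family_on_def)
  moreover have "(\<lambda>k. prob (?B k)) sums 1"
    using sums_mult[OF exp_converges[of l], of "exp (- l)"]
    by (simp add: num_poisson[OF A] l_def field_simps flip: exp_add)
  ultimately have "prob (\<Union>k. ?B k) = 1"
    by (rule sums_unique2)
  then have "AE \<omega> in M. \<omega> \<in> (\<Union>k. ?B k)"
    by (rule AE_prob_1)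
  then show ?thesis
    by eventually_elim (auto simp: num_pts_eq_of_nat_iff)
qed

text \<open>This is the probability generating function of a Poisson variable. Writing
  \<open>q ^ N\<close> as a series over the values of \<open>N\<close> lets series and integral be
  exchanged; an infinite count contributes 0.\<close>

lemma nn_integral_power_num_pts:
  assumes A: "A \<in> sets borel" "bounded A" and q: "0 \<le> q"
  shows "(\<integral>\<^sup>+\<omega>. (\<Sum>k. ennreal (q ^ k) * indicator {of_nat k} (num_pts X A \<omega>)) \<partial>M) =
    ennreal (exp (- (\<nu> * (measure lborel A * (1 - q)))))"
proof -
  note [measurable] = num_pts_measurable[OF A(1)]
  define l where "l = \<nu> * measure lborel A"
  have l: "0 \<le> l" using intensity_pos by (simp add: l_def)
  let ?B = "\<lambda>k. {\<omega> \<in> space M. num_pts X A \<omega> = of_nat k}"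
  have eq: "(\<integral>\<^sup>+\<omega>. ennreal (q ^ k) * indicator {of_nat k} (num_pts X A \<omega>) \<partial>M) =
      ennreal (exp (- l) * ((q * l) ^ k / fact k))" for k
  proof -
    have "(\<integral>\<^sup>+\<omega>. ennreal (q ^ k) * indicator {of_nat k} (num_pts X A \<omega>) \<partial>M) =
        (\<integral>\<^sup>+\<omega>. ennreal (q ^ k) * indicator (?B k) \<omega> \<partial>M)"
      by (intro nn_integral_cong) (auto simp: indicator_def)
    also have "\<dots> = ennreal (q ^ k) * emeasure M (?B k)"
      by (intro nn_integral_cmult_indicator) measurable
    also have "\<dots> = ennreal (q ^ k * (exp (- l) * l ^ k / fact k))"
      using q l num_poisson[OF A, of k]
      by (subst ennreal_mult) (simp_all add: emeasure_eq_measure l_def)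
    finally show ?thesis by (simp add: power_mult_distrib mult_ac)
  qed
  have "(\<integral>\<^sup>+\<omega>. (\<Sum>k. ennreal (q ^ k) * indicator {of_nat k} (num_pts X A \<omega>)) \<partial>M) =
      (\<Sum>k. ennreal (exp (- l) * ((q * l) ^ k / fact k)))"
    by (subst nn_integral_suminf) (simp_all add: eq)
  also have "\<dots> = ennreal (exp (- l) * exp (q * l))"
    using sums_mult[OF exp_converges[of "q * l"], of "exp (- l)"] q l
    by (intro suminf_ennreal_eq) (auto simp: field_simps)
  also have "exp (- l) * exp (q * l) = exp (- (\<nu> * (measure lborel A * (1 - q))))"
    by (simp add: mult_exp_exp l_def algebra_simps)
  finally show ?thesis .
qed

text \<open>Counts in disjoint sets are independent, so the integral factors into generating
  functions and their exponents add.\<close>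

lemma nn_integral_prod_power_card:
  fixes A :: "nat \<Rightarrow> 'a set" and q :: "nat \<Rightarrow> real"
  assumes J: "finite J" and A: "\<And>j. j \<in> J \<Longrightarrow> A j \<in> sets borel" "\<And>j. j \<in> J \<Longrightarrow> bounded (A j)"
    and disj: "disjoint_family_on A J" and q: "\<And>j. j \<in> J \<Longrightarrow> 0 \<le> q j"
  shows "(\<integral>\<^sup>+\<omega>. (\<Prod>j\<in>J. ennreal (q j ^ card {i. X i \<omega> \<in> A j})) \<partial>M) =
    ennreal (exp (- (\<nu> * (\<Sum>j\<in>J. measure lborel (A j) * (1 - q j)))))"
proof -
  \<comment> \<open>\<open>f j\<close> extends \<open>q j ^ n\<close> to a Borel function on all of
    \<open>ennreal\<close>, as composition with the independent extended-valued counts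
    requires.\<close>
  define f where "f j t = (\<Sum>k. ennreal (q j ^ k) * indicator {of_nat k} t)" for j and t :: ennreal
  have f_meas: "f j \<in> borel_measurable borel" for j
    unfolding f_def[abs_def] by measurable
  have f_of_nat: "f j (of_nat n) = ennreal (q j ^ n)" for j n
  proof -
    have "f j (of_nat n) = (\<Sum>k. if k = n then ennreal (q j ^ n) else 0)"
      unfolding f_def by (intro suminf_cong) (auto simp: indicator_def)
    then show ?thesis
      using sums_unique[OF sums_single[of n "\<lambda>_. ennreal (q j ^ n)"]] by simp
  qed
  have "AE \<omega> in M. \<forall>j\<in>J. finite {i. X i \<omega> \<in> A j}"
    using J A by (subst AE_finite_all) (auto intro: AE_finite_points)
  then have "(\<integral>\<^sup>+\<omega>. (\<Prod>j\<in>J. ennreal (q j ^ card {i. X i \<omega> \<in> A j})) \<partial>M) =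
      (\<integral>\<^sup>+\<omega>. (\<Prod>j\<in>J. f j (num_pts X (A j) \<omega>)) \<partial>M)"
    by (intro nn_integral_cong_AE, eventually_elim)
       (auto intro!: prod.cong simp: num_pts_eq_card f_of_nat)
  also have "\<dots> = (\<Prod>j\<in>J. \<integral>\<^sup>+\<omega>. f j (num_pts X (A j) \<omega>) \<partial>M)"
  proof (rule indep_vars_nn_integral[OF J])
    have "indep_vars (\<lambda>_. borel) (\<lambda>j. num_pts X (A j)) J"
      using J A disj by (intro num_indep) auto
    then show "indep_vars (\<lambda>_. borel) (\<lambda>j \<omega>. f j (num_pts X (A j) \<omega>)) J"
      by (rule indep_vars_compose2) (rule f_meas)
  qed auto
  also have "\<dots> = (\<Prod>j\<in>J. ennreal (exp (- (\<nu> * (measure lborel (A j) * (1 - q j))))))"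
    using A q by (intro prod.cong refl) (simp add: f_def nn_integral_power_num_pts)
  also have "\<dots> = ennreal (exp (- (\<nu> * (\<Sum>j\<in>J. measure lborel (A j) * (1 - q j)))))"
    by (simp add: prod_ennreal exp_sum J sum_distrib_left sum_negf[symmetric])
  finally show ?thesis .
qed

end

section \<open>Immigrants marked by their centered clusters\<close>

context spatial_poisson_cluster_process
begin

lemma centered_measurable: "centered X C i \<in> measurable M mset_space"
  using centered_indep by (auto simp: indep_vars_def)

lemma prob_centered:
  assumes "G \<in> sets mset_space"
  shows "prob (centered X C i -` G \<inter> space M) = measure Q G"
  using assms by (simp add: measure_distr[OF centered_measurable] flip: centered_law[of i])

lemma prob_space_Q: "prob_space Q"
  unfolding centered_law[symmetric, of 0] by (rule prob_space_distr[OF centered_measurable])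

lemma sets_Q: "sets Q = sets mset_space"
  unfolding centered_law[symmetric, of 0] by simp

lemma immigrants_measurable: "(\<lambda>\<omega> i. X i \<omega>) \<in> measurable M (PiM UNIV (\<lambda>_. borel))"
  using points_measurable by (intro measurable_PiM_single') auto

lemma centered_family_measurable:
  "(\<lambda>\<omega> i. centered X C i \<omega>) \<in> measurable M (PiM UNIV (\<lambda>_. mset_space))"
  using centered_measurable by (intro measurable_PiM_single') auto

lemma prob_marks:
  assumes I: "finite I" and G: "\<And>i. i \<in> I \<Longrightarrow> G i \<in> sets mset_space"
  shows "prob {\<omega> \<in> space M. \<forall>i\<in>I. centered X C i \<omega> \<in> G i} = (\<Prod>i\<in>I. measure Q (G i))"
\<comment> \<open>An intersection over the empty index set would be \<open>UNIV\<close> instead of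
  \<open>space M\<close>, hence the separate case.\<close>
proof (cases "I = {}")
  case False
  have "prob (\<Inter>i\<in>I. centered X C i -` G i \<inter> space M) =
      (\<Prod>i\<in>I. prob (centered X C i -` G i \<inter> space M))"
    using False I G by (intro indep_varsD[OF centered_indep]) auto
  also have "\<dots> = (\<Prod>i\<in>I. measure Q (G i))"
    using G by (intro prod.cong refl prob_centered)
  also have "(\<Inter>i\<in>I. centered X C i -` G i \<inter> space M) =
      {\<omega> \<in> space M. \<forall>i\<in>I. centered X C i \<omega> \<in> G i}"
    using False by auto
  finally show ?thesis .
qed (simp add: prob_space)

text \<open>Given the immigrants, their marks are independent with law \<open>Q\<close>, so the
  conditional probability is the product of \<open>measure Q (G j)\<close> to the power of the
  number of immigrants in \<open>A j\<close>. Averaging by the generating functions gives the void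
  probability of the thinned process of immigrants in \<open>A j\<close> with mark outside
  \<open>G j\<close>.\<close>

lemma prob_marked_immigrants:
  fixes A :: "nat \<Rightarrow> 'a set" and G :: "nat \<Rightarrow> 'a multiset set"
  assumes J: "finite J" and A: "\<And>j. j \<in> J \<Longrightarrow> A j \<in> sets borel" "\<And>j. j \<in> J \<Longrightarrow> bounded (A j)"
    and disj: "disjoint_family_on A J" and G: "\<And>j. j \<in> J \<Longrightarrow> G j \<in> sets mset_space"
  shows "{\<omega> \<in> space M. \<forall>i. \<forall>j\<in>J. X i \<omega> \<in> A j \<longrightarrow> centered X C i \<omega> \<in> G j} \<in> events" (is ?meas)
    and "prob {\<omega> \<in> space M. \<forall>i. \<forall>j\<in>J. X i \<omega> \<in> A j \<longrightarrow> centered X C i \<omega> \<in> G j} =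
      exp (- (\<nu> * (\<Sum>j\<in>J. measure lborel (A j) * (1 - measure Q (G j)))))" (is ?prob)
proof -
  let ?PX = "PiM UNIV (\<lambda>_::nat. borel) :: (nat \<Rightarrow> 'a) measure"
  let ?PC = "PiM UNIV (\<lambda>_::nat. mset_space) :: (nat \<Rightarrow> 'a multiset) measure"
  let ?X = "\<lambda>\<omega> i. X i \<omega>" and ?C = "\<lambda>\<omega> i. centered X C i \<omega>"
  let ?E = "{\<omega> \<in> space M. \<forall>i. \<forall>j\<in>J. X i \<omega> \<in> A j \<longrightarrow> centered X C i \<omega> \<in> G j}"
  \<comment> \<open>The event is pulled back from a set of pairs of sequences, where it is a
    countable intersection of measurable conditions on coordinates.\<close>
  define S where "S = {p \<in> space (?PX \<Otimes>\<^sub>M ?PC). \<forall>i. \<forall>j\<in>J. fst p i \<in> A j \<longrightarrow> snd p i \<in> G j}"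
  note Xm = immigrants_measurable and Cm = centered_family_measurable
  have pair: "(\<lambda>\<omega>. (?X \<omega>, ?C \<omega>)) \<in> measurable M (?PX \<Otimes>\<^sub>M ?PC)"
    using Xm Cm by measurable
  have S: "S \<in> sets (?PX \<Otimes>\<^sub>M ?PC)"
  proof -
    have "Measurable.pred (?PX \<Otimes>\<^sub>M ?PC) (\<lambda>p. fst p i \<in> A j \<longrightarrow> snd p i \<in> G j)" if "j \<in> J" for i j
    proof -
      note [measurable] = A(1)[OF that] G[OF that]
      show ?thesis by measurable
    qed
    then show ?thesis
      unfolding S_def pred_def[symmetric] using J
      by (intro pred_intros_countable pred_intros_finite)
  qed
  have E_eq: "(\<lambda>\<omega>. (?X \<omega>, ?C \<omega>)) -` S \<inter> space M = ?E"
    by (auto simp: S_def space_pair_measure space_PiM)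
  show ?meas
    using measurable_sets[OF pair S] by (simp add: E_eq)
  interpret PC: prob_space "distr M ?PC ?C"
    by (rule prob_space_distr[OF Cm])
  have "emeasure M ?E = emeasure (distr M (?PX \<Otimes>\<^sub>M ?PC) (\<lambda>\<omega>. (?X \<omega>, ?C \<omega>))) S"
    using pair S by (simp add: emeasure_distr E_eq)
  also have "distr M (?PX \<Otimes>\<^sub>M ?PC) (\<lambda>\<omega>. (?X \<omega>, ?C \<omega>)) = distr M ?PX ?X \<Otimes>\<^sub>M distr M ?PC ?C"
    by (rule distr_pair_indep_set[OF Xm Cm centered_indep_immigrants])
  \<comment> \<open>By Fubini the immigrants can be frozen while the marks are integrated.\<close>
  also have "emeasure \<dots> S = (\<integral>\<^sup>+x. emeasure (distr M ?PC ?C) (Pair x -` S) \<partial>distr M ?PX ?X)"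
    using S by (intro PC.emeasure_pair_measure_alt) simp
  also have "\<dots> = (\<integral>\<^sup>+\<omega>. emeasure (distr M ?PC ?C) (Pair (?X \<omega>) -` S) \<partial>M)"
    using S Xm by (intro nn_integral_distr PC.measurable_emeasure_Pair) simp_all
  also have "\<dots> = (\<integral>\<^sup>+\<omega>. (\<Prod>j\<in>J. ennreal (measure Q (G j) ^ card {i. X i \<omega> \<in> A j})) \<partial>M)"
  proof (rule nn_integral_cong_AE)
    have "AE \<omega> in M. \<forall>j\<in>J. finite {i. X i \<omega> \<in> A j}"
      using J A by (subst AE_finite_all) (auto intro: AE_finite_points)
    then show "AE \<omega> in M. emeasure (distr M ?PC ?C) (Pair (?X \<omega>) -` S) =
        (\<Prod>j\<in>J. ennreal (measure Q (G j) ^ card {i. X i \<omega> \<in> A j}))"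
    proof eventually_elim
      case (elim \<omega>)
      let ?N = "\<lambda>j. {i. X i \<omega> \<in> A j}"
      \<comment> \<open>\<open>k i\<close> is the index of the set containing immigrant
        \<open>i\<close>, unique by disjointness. Its value is used only for immigrants in the union
        of the sets.\<close>
      define k where "k i = (THE j. j \<in> J \<and> X i \<omega> \<in> A j)" for i
      have k: "k i = j" if "j \<in> J" "i \<in> ?N j" for i j
        unfolding k_def using that disj by (intro the_equality) (auto simp: disjoint_family_on_def)
      have fin: "finite (\<Union>j\<in>J. ?N j)" using J elim by auto
      have kJ: "k i \<in> J" if "i \<in> (\<Union>j\<in>J. ?N j)" for i using that k by auto
      have "emeasure (distr M ?PC ?C) (Pair (?X \<omega>) -` S) =
          emeasure M (?C -` (Pair (?X \<omega>) -` S) \<inter> space M)"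
        using S Cm by (intro emeasure_distr sets_Pair1) auto
      also have "?C -` (Pair (?X \<omega>) -` S) \<inter> space M =
          {\<omega>' \<in> space M. \<forall>i\<in>(\<Union>j\<in>J. ?N j). centered X C i \<omega>' \<in> G (k i)}"
        using k by (auto simp: S_def space_pair_measure space_PiM)
      also have "emeasure M \<dots> = ennreal (\<Prod>i\<in>(\<Union>j\<in>J. ?N j). measure Q (G (k i)))"
        using prob_marks[OF fin, of "\<lambda>i. G (k i)"] G kJ by (simp add: emeasure_eq_measure)
      also have "(\<Prod>i\<in>(\<Union>j\<in>J. ?N j). measure Q (G (k i))) =
          (\<Prod>j\<in>J. \<Prod>i\<in>?N j. measure Q (G (k i)))"
        using J elim disj by (intro prod.UNION_disjoint) (auto simp: disjoint_family_on_def)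
      also have "\<dots> = (\<Prod>j\<in>J. measure Q (G j) ^ card (?N j))"
      proof (rule prod.cong[OF refl])
        fix j assume "j \<in> J"
        then have "(\<Prod>i\<in>?N j. measure Q (G (k i))) = (\<Prod>i\<in>?N j. measure Q (G j))"
          using k by (intro prod.cong refl) auto
        then show "(\<Prod>i\<in>?N j. measure Q (G (k i))) = measure Q (G j) ^ card (?N j)"
          by simp
      qed
      finally show ?case by (simp add: prod_ennreal)
    qed
  qed
  also have "\<dots> = ennreal (exp (- (\<nu> * (\<Sum>j\<in>J. measure lborel (A j) * (1 - measure Q (G j))))))"
    using J A disj by (intro nn_integral_prod_power_card) auto
  finally show ?prob
    by (simp add: emeasure_eq_measure)
qed

section \<open>Bounds for the void probability\<close>

lemma void_measurable:
  assumes A: "A \<in> sets borel"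
  shows "{\<omega> \<in> space M. cluster_num C A \<omega> = 0} \<in> events"
proof -
  note [measurable] = clusters_measurable
  have "{\<omega> \<in> space M. cluster_num C A \<omega> = 0} =
      {\<omega> \<in> space M. \<forall>i. C i \<omega> \<in> {m. mset_num A m = 0}}"
    by (auto simp: cluster_num_eq_0_iff mset_num_eq_0_iff)
  also have "\<dots> \<in> events"
    using sets_mset_num_eq[OF A, of 0] by measurable
  finally show ?thesis .
qed

text \<open>Almost surely every immigrant lies in its own cluster, so a set free of cluster points
  is free of immigrants, an event of Poisson probability with \<open>k = 0\<close>.\<close>

lemma prob_void_le:
  assumes A: "A \<in> sets borel" "bounded A"
  shows "prob {\<omega> \<in> space M. cluster_num C A \<omega> = 0} \<le> exp (- (\<nu> * measure lborel A))"
proof -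
  note [measurable] = num_pts_measurable[OF A(1)]
  have "AE \<omega> in M. \<forall>i. X i \<omega> \<in># C i \<omega>"
    using immigrant_in_cluster by (simp add: AE_all_countable)
  then have "AE \<omega> in M. cluster_num C A \<omega> = 0 \<longrightarrow> num_pts X A \<omega> = of_nat 0"
  proof eventually_elim
    case (elim \<omega>)
    show ?case
    proof
      assume "cluster_num C A \<omega> = 0"
      with elim have "{i. X i \<omega> \<in> A} = {}" by (auto simp: cluster_num_eq_0_iff)
      then show "num_pts X A \<omega> = of_nat 0" by (simp add: num_pts_eq_card)
    qed
  qed
  then have "prob {\<omega> \<in> space M. cluster_num C A \<omega> = 0} \<le>
      prob {\<omega> \<in> space M. num_pts X A \<omega> = of_nat 0}"
    by (intro finite_measure_mono_AE) auto
  also have "\<dots> = exp (- (\<nu> * measure lborel A))"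
    by (subst num_poisson[OF A]) simp
  finally show ?thesis .
qed

text \<open>Integrability supplies measurability of the power of the radius, and taking a root
  recovers the radius up to sign. The absolute value also covers the empty multiset, whose radius is
  a supremum over the empty set.\<close>

lemma abs_cluster_radius_measurable:
  assumes "integrable Q (\<lambda>m. cluster_radius m ^ DIM('a))"
  shows "(\<lambda>m. \<bar>cluster_radius m\<bar>) \<in> borel_measurable Q"
proof -
  have "(\<lambda>m. root DIM('a) \<bar>cluster_radius m ^ DIM('a)\<bar>) \<in> borel_measurable Q"
    using borel_measurable_integrable[OF assms] by measurable
  then show ?thesis by (simp add: power_abs real_root_power_cancel)
qed

text \<open>A sum is at most twice the larger term, and the power of a maximum is at most the sum of
  the powers.\<close>

lemma integrable_add_radius_power:
  assumes int: "integrable Q (\<lambda>m. cluster_radius m ^ DIM('a))" and a: "0 \<le> a"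
  shows "integrable Q (\<lambda>m. (a + \<bar>cluster_radius m\<bar>) ^ DIM('a))"
proof -
  interpret Q: prob_space Q by (rule prob_space_Q)
  note [measurable] = abs_cluster_radius_measurable[OF int]
  show ?thesis
  proof (rule Bochner_Integration.integrable_bound)
    show "integrable Q (\<lambda>m. 2 ^ DIM('a) * (a ^ DIM('a) + \<bar>cluster_radius m ^ DIM('a)\<bar>))"
      using int by simp
    show "AE m in Q. norm ((a + \<bar>cluster_radius m\<bar>) ^ DIM('a)) \<le>
        norm (2 ^ DIM('a) * (a ^ DIM('a) + \<bar>cluster_radius m ^ DIM('a)\<bar>))"
    proof (rule AE_I2)
      fix m :: "'a multiset"
      have "(a + \<bar>cluster_radius m\<bar>) ^ DIM('a) \<le> (2 * max a \<bar>cluster_radius m\<bar>) ^ DIM('a)"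
        using a by (intro power_mono) auto
      also have "\<dots> \<le> 2 ^ DIM('a) * (a ^ DIM('a) + \<bar>cluster_radius m ^ DIM('a)\<bar>)"
        using a by (simp add: power_mult_distrib max_def power_abs)
      finally show "norm ((a + \<bar>cluster_radius m\<bar>) ^ DIM('a)) \<le>
          norm (2 ^ DIM('a) * (a ^ DIM('a) + \<bar>cluster_radius m ^ DIM('a)\<bar>))"
        using a by (simp add: power_abs)
    qed
  qed measurable
qed

text \<open>Immigrants are sorted into unit shells \<open>B j\<close> around \<open>cball 0 r\<close>; it suffices that those in
  \<open>B j\<close> have clusters of radius less than \<open>j\<close>. The innermost shell \<open>B 0\<close> is the whole ball of
  radius \<open>r + 1\<close>, and this rounding is negligible compared with the volume of the ball.\<close>

lemma prob_void_ball_ge: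
  assumes int: "integrable Q (\<lambda>m. cluster_radius m ^ DIM('a))" and r: "0 \<le> r"
  shows "exp (- (\<nu> * (unit_ball_vol DIM('a) *
      (\<integral>m. (r + 1 + \<bar>cluster_radius m\<bar>) ^ DIM('a) \<partial>Q)))) \<le>
    prob {\<omega> \<in> space M. cluster_num C (cball 0 r) \<omega> = 0}"
proof -
  interpret Q: prob_space Q by (rule prob_space_Q)
  note [measurable] = abs_cluster_radius_measurable[OF int]
  define B :: "nat \<Rightarrow> 'a set" where
    "B j = (if j = 0 then cball 0 (r + 1) else cball 0 (r + 1 + j) - cball 0 (r + j))" for j
  \<comment> \<open>Smallness of the cluster is stated as a vanishing count because such sets
    generate \<open>mset_space\<close>. \<open>G 0\<close> contains only the empty multiset.\<close>
  define G :: "nat \<Rightarrow> 'a multiset set" where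
    "G j = {m. mset_num {y. real j \<le> norm y} m = 0}" for j
  \<comment> \<open>Only finitely many shells are treated at once, as the formula for marked
    immigrants requires; \<open>n\<close> goes to infinity later.\<close>
  define E where
    "E n = {\<omega> \<in> space M. \<forall>i. \<forall>j\<in>{..<n}. X i \<omega> \<in> B j \<longrightarrow> centered X C i \<omega> \<in> G j}" for n
  have B_borel: "B j \<in> sets borel" and B_sub: "B j \<subseteq> cball 0 (r + 1 + j)" for j
    by (auto simp: B_def)
  have B_bounded: "bounded (B j)" for j
    using B_sub bounded_cball bounded_subset by blast
  have B_disj: "B j \<inter> B k = {}" if "j < k" for j k
  proof -
    have "real j + 1 \<le> real k" using that by linarith
    then show ?thesis using that by (auto simp: B_def)
  qed
  have disj: "disjoint_family_on B J" for J
    unfolding disjoint_family_on_def using B_disj by (metis Int_commute linorder_neqE_nat)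
  have G_sets: "G j \<in> sets mset_space" for j
    unfolding G_def by (intro sets_mset_num_eq) measurable
  \<comment> \<open>For a fixed radius, the shells with index at most that radius are disjoint and
    lie in one ball, whose volume bounds their total. Integrating over \<open>Q\<close> gives the
    exponent.\<close>
  have shells: "(\<Sum>j<n. measure lborel (B j) * indicator {m \<in> space Q. real j \<le> \<bar>cluster_radius m\<bar>} m)
      \<le> unit_ball_vol DIM('a) * (r + 1 + \<bar>cluster_radius m\<bar>) ^ DIM('a)" (is "?lhs \<le> ?rhs")
    for n and m :: "'a multiset"
  proof -
    let ?J = "{j. j < n \<and> real j \<le> \<bar>cluster_radius m\<bar>}"
    have "?lhs \<le> (\<Sum>j<n. if real j \<le> \<bar>cluster_radius m\<bar> then measure lborel (B j) else 0)"
      by (intro sum_mono) (auto simp: indicator_def)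
    also have "\<dots> = (\<Sum>j\<in>?J. measure lborel (B j))"
      by (subst sum.inter_filter[symmetric]) auto
    also have "\<dots> = measure lborel (\<Union>j\<in>?J. B j)"
      using B_borel disj emeasure_bounded_finite[OF B_bounded]
      by (intro measure_finite_Union[symmetric]) (auto simp: less_top)
    also have "\<dots> \<le> measure lborel (cball (0::'a) (r + 1 + \<bar>cluster_radius m\<bar>))"
    proof (rule measure_mono_fmeasurable)
      show "(\<Union>j\<in>?J. B j) \<subseteq> cball 0 (r + 1 + \<bar>cluster_radius m\<bar>)"
        using B_sub by fastforce
    qed (use B_borel in \<open>auto intro!: fmeasurableI emeasure_bounded_finite\<close>)
    also have "\<dots> = ?rhs"
      using r by (simp add: content_cball)
    finally show ?thesis .
  qed
  \<comment> \<open>A mark outside \<open>G j\<close> has a point of norm at least \<open>j\<close>,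
    so its radius is at least \<open>j\<close>.\<close>
  have tail: "1 - measure Q (G j) \<le> measure Q {m \<in> space Q. real j \<le> \<bar>cluster_radius m\<bar>}" for j
  proof -
    have "1 - measure Q (G j) = measure Q (space Q - G j)"
      using G_sets by (simp add: Q.prob_compl sets_Q)
    also have "\<dots> \<le> measure Q {m \<in> space Q. real j \<le> \<bar>cluster_radius m\<bar>}"
    proof (rule Q.finite_measure_mono)
      show "space Q - G j \<subseteq> {m \<in> space Q. real j \<le> \<bar>cluster_radius m\<bar>}"
      proof safe
        fix m assume "m \<notin> G j"
        then obtain y where y: "y \<in># m" "real j \<le> norm y"
          by (auto simp: G_def mset_num_eq_0_iff)
        have "norm y \<le> cluster_radius m"
          unfolding cluster_radius_def using y by (intro cSUP_upper) auto
        then show "real j \<le> \<bar>cluster_radius m\<bar>" using y by linarith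
      qed
    qed measurable
    finally show ?thesis .
  qed
  have "exp (- (\<nu> * (unit_ball_vol DIM('a) *
      (\<integral>m. (r + 1 + \<bar>cluster_radius m\<bar>) ^ DIM('a) \<partial>Q)))) \<le> prob (E n)" for n
  proof -
    have "(\<Sum>j<n. measure lborel (B j) * (1 - measure Q (G j))) \<le>
        (\<Sum>j<n. measure lborel (B j) * measure Q {m \<in> space Q. real j \<le> \<bar>cluster_radius m\<bar>})"
      by (intro sum_mono mult_left_mono tail) auto
    also have "\<dots> = (\<integral>m. (\<Sum>j<n. measure lborel (B j) *
        indicator {m \<in> space Q. real j \<le> \<bar>cluster_radius m\<bar>} m) \<partial>Q)"
      by (subst Bochner_Integration.integral_sum) (auto simp: Q.emeasure_eq_measure)
    also have "\<dots> \<le> (\<integral>m. unit_ball_vol DIM('a) * (r + 1 + \<bar>cluster_radius m\<bar>) ^ DIM('a) \<partial>Q)"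
      using integrable_add_radius_power[OF int, of "r + 1"] r
      by (intro integral_mono shells Bochner_Integration.integrable_sum integrable_mult_right
          integrable_real_indicator) (auto simp: Q.emeasure_eq_measure)
    finally show ?thesis
      unfolding E_def using B_borel B_bounded disj G_sets intensity_pos
      by (subst prob_marked_immigrants(2)) auto
  qed
  \<comment> \<open>The events decrease in \<open>n\<close>, so continuity from above carries the
    uniform bound over to all shells together.\<close>
  moreover have "(\<lambda>n. prob (E n)) \<longlonglongrightarrow> prob (\<Inter>n. E n)"
  proof (rule finite_Lim_measure_decseq)
    show "range E \<subseteq> events"
      unfolding E_def using B_borel B_bounded disj G_sets
      by (auto intro!: prob_marked_immigrants(1))
    show "decseq E" by (auto simp: E_def decseq_def)
  qed
  ultimately have "exp (- (\<nu> * (unit_ball_vol DIM('a) *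
      (\<integral>m. (r + 1 + \<bar>cluster_radius m\<bar>) ^ DIM('a) \<partial>Q)))) \<le> prob (\<Inter>n. E n)"
    by (intro LIMSEQ_le_const) auto
  also have "\<dots> \<le> prob {\<omega> \<in> space M. cluster_num C (cball 0 r) \<omega> = 0}"
  proof (rule finite_measure_mono)
    show "(\<Inter>n. E n) \<subseteq> {\<omega> \<in> space M. cluster_num C (cball 0 r) \<omega> = 0}"
    proof
      fix \<omega> assume \<omega>: "\<omega> \<in> (\<Inter>n. E n)"
      have "y \<notin> cball 0 r" if y: "y \<in># C i \<omega>" for i y
      proof -
        \<comment> \<open>Shell \<open>j > 0\<close> consists of the points whose distance from the
          origin exceeds \<open>r\<close> by more than \<open>j\<close> and at most
          \<open>j + 1\<close>, hence the ceiling minus one; \<open>nat\<close> sends the whole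
          inner ball to 0.\<close>
        define j where "j = nat (\<lceil>norm (X i \<omega>) - r\<rceil> - 1)"
        have XB: "X i \<omega> \<in> B j"
          using r unfolding j_def B_def by (cases "norm (X i \<omega>) \<le> r + 1") (auto, linarith+)
        have "\<omega> \<in> E (Suc j)" using \<omega> by blast
        then have "centered X C i \<omega> \<in> G j" using XB by (auto simp: E_def)
        then have *: "norm (y - X i \<omega>) < real j"
          using y by (auto simp: G_def mset_num_eq_0_iff centered_def)
        \<comment> \<open>For \<open>j = 0\<close> the strict bound would make a norm negative: a
          point of the cluster rules out the innermost shell.\<close>
        then have "j \<noteq> 0" by (intro notI) simp
        then have "r + real j < norm (X i \<omega>)" using XB by (auto simp: B_def)
        then show ?thesis
          using * norm_triangle_ineq2[of "X i \<omega>" y] by (simp add: norm_minus_commute)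
      qed
      then show "\<omega> \<in> {\<omega> \<in> space M. cluster_num C (cball 0 r) \<omega> = 0}"
        using \<omega> by (auto simp: cluster_num_eq_0_iff E_def)
    qed
  qed (intro void_measurable, simp)
  finally show ?thesis .
qed

section \<open>Asymptotic equality of the volumes\<close>

text \<open>Dominated convergence: the ratio is \<open>1 + (1 + L) / r\<close> with \<open>L\<close>
  the absolute radius, which tends to 1.\<close>

lemma relative_volume_limit:
  assumes int: "integrable Q (\<lambda>m. cluster_radius m ^ DIM('a))"
  shows "((\<lambda>r. \<integral>m. ((r + 1 + \<bar>cluster_radius m\<bar>) / r) ^ DIM('a) \<partial>Q) \<longlongrightarrow> 1) at_top"
proof -
  interpret Q: prob_space Q by (rule prob_space_Q)
  note [measurable] = abs_cluster_radius_measurable[OF int]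
  have "((\<lambda>r. \<integral>m. ((r + 1 + \<bar>cluster_radius m\<bar>) / r) ^ DIM('a) \<partial>Q) \<longlongrightarrow> (\<integral>m. 1 \<partial>Q)) at_top"
  proof (rule integral_dominated_convergence_at_top)
    \<comment> \<open>The ratio decreases in \<open>r\<close>, so for \<open>r \<ge> 1\<close> it is
      dominated by its value \<open>2 + L\<close> at \<open>r = 1\<close>.\<close>
    show "integrable Q (\<lambda>m. (2 + \<bar>cluster_radius m\<bar>) ^ DIM('a))"
      by (rule integrable_add_radius_power[OF int]) simp
    show "AE m in Q. ((\<lambda>r. ((r + 1 + \<bar>cluster_radius m\<bar>) / r) ^ DIM('a)) \<longlongrightarrow> 1) at_top"
    proof (rule AE_I2)
      fix m :: "'a multiset"
      have "((\<lambda>r. 1 + (1 + \<bar>cluster_radius m\<bar>) / r) \<longlongrightarrow> 1 + 0) at_top"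
        by (intro tendsto_add tendsto_const tendsto_divide_0[OF tendsto_const]
            filterlim_at_top_imp_at_infinity filterlim_ident)
      then have "((\<lambda>r. (r + 1 + \<bar>cluster_radius m\<bar>) / r) \<longlongrightarrow> 1 + 0) at_top"
      proof (rule Lim_transform_eventually)
        show "\<forall>\<^sub>F r in at_top. 1 + (1 + \<bar>cluster_radius m\<bar>) / r =
            (r + 1 + \<bar>cluster_radius m\<bar>) / r"
          using eventually_gt_at_top[of 0] by eventually_elim (simp add: field_simps)
      qed
      then show "((\<lambda>r. ((r + 1 + \<bar>cluster_radius m\<bar>) / r) ^ DIM('a)) \<longlongrightarrow> 1) at_top"
        using tendsto_power[of _ 1 at_top "DIM('a)"] by fastforce
    qed
    show "\<forall>\<^sub>F r in at_top. AE m in Q. norm (((r + 1 + \<bar>cluster_radius m\<bar>) / r) ^ DIM('a))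
        \<le> (2 + \<bar>cluster_radius m\<bar>) ^ DIM('a)"
      using eventually_ge_at_top[of 1]
    proof eventually_elim
      case (elim r)
      have "(r + 1 + k) / r \<le> 2 + k" if "0 \<le> k" for k
      proof -
        have "1 * (1 + k) \<le> r * (1 + k)"
          using elim that by (intro mult_right_mono) auto
        then show ?thesis using elim by (simp add: field_simps)
      qed
      then show ?case
        using elim by (auto simp: norm_power intro!: power_mono)
    qed
  qed measurable
  then show ?thesis by (simp add: Q.prob_space)
qed

end

section \<open>The iterated logarithm\<close>

text \<open>Both bounds come from \<open>ln x \<le> x - 1\<close>, taken at \<open>1 - p\<close> and
  at its inverse; \<open>p \<le> 1 / 2\<close> gives \<open>p / (1 - p) \<le> 2 * p\<close>. The
  remaining gap \<open>ln 2\<close> vanishes on division by the volume.\<close>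

lemma ln_neg_ln_one_minus_bounds:
  fixes p :: real
  assumes "0 < p" "p \<le> 1 / 2"
  shows "ln p \<le> ln (ln (inverse (1 - p)))" "ln (ln (inverse (1 - p))) \<le> ln 2 + ln p"
proof -
  have "p \<le> - ln (1 - p)" using assms ln_le_minus_one[of "1 - p"] by simp
  then have lower: "p \<le> ln (inverse (1 - p))" using assms by (simp add: ln_inverse)
  have "ln (inverse (1 - p)) \<le> inverse (1 - p) - 1"
    using assms by (intro ln_le_minus_one) simp
  also have "inverse (1 - p) - 1 \<le> 2 * p"
  proof -
    have "p * (2 * p) \<le> p * 1" using assms by (intro mult_left_mono) auto
    then show ?thesis using assms by (simp add: field_simps)
  qed
  finally have upper: "ln (inverse (1 - p)) \<le> 2 * p" .
  show "ln p \<le> ln (ln (inverse (1 - p)))"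
    using assms(1) lower by (intro ln_mono)
  have "ln (ln (inverse (1 - p))) \<le> ln (2 * p)"
    using assms(1) lower upper by (intro ln_mono) linarith+
  then show "ln (ln (inverse (1 - p))) \<le> ln 2 + ln p"
    using assms by (simp add: ln_mult)
qed

lemma ball_volume_eq: "ball_volume d r = unit_ball_vol (real d) * r ^ d"
  by (simp add: ball_volume_def unit_ball_vol_def add.commute)

lemma filterlim_ball_volume:
  assumes "0 < d"
  shows "filterlim (ball_volume d) at_top at_top"
  unfolding ball_volume_eq[abs_def] using assms
  by (intro filterlim_tendsto_pos_mult_at_top[OF tendsto_const] filterlim_pow_at_top filterlim_ident)
     auto

section \<open>The limit by squeezing\<close>

theorem corollary5p4:
  fixes M :: "'w measure" and \<nu> :: real
    and X :: "nat \<Rightarrow> 'w \<Rightarrow> 'a::euclidean_space"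
    and C :: "nat \<Rightarrow> 'w \<Rightarrow> 'a multiset" and Q :: "'a multiset measure"
  assumes "spatial_poisson_cluster_process M \<nu> X C Q"
    and "integrable Q (\<lambda>m. real (size m))"
    and "integrable Q (\<lambda>m. cluster_radius m ^ DIM('a))"
  shows "((\<lambda>r. 1 / ball_volume DIM('a) r * ln (ln (inverse (empty_space_function M C r))))
           \<longlongrightarrow> - \<nu>) at_top"
proof -
  interpret spatial_poisson_cluster_process M \<nu> X C Q by fact
  note int = assms(3)
  let ?V = "ball_volume DIM('a)"
  let ?L = "\<lambda>r. ln (ln (inverse (empty_space_function M C r)))"
  define p where "p r = prob {\<omega> \<in> space M. cluster_num C (cball 0 r) \<omega> = 0}" for r
  \<comment> \<open>\<open>h r\<close> is the mean volume of the enlarged ball relative to that of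
    radius \<open>r\<close>; factoring out \<open>?V r\<close> leaves a quantity tending to
    1.\<close>
  define h where "h r = (\<integral>m. ((r + 1 + \<bar>cluster_radius m\<bar>) / r) ^ DIM('a) \<partial>Q)" for r
  have V_lim: "filterlim ?V at_top at_top"
    by (rule filterlim_ball_volume) simp
  have upper: "p r \<le> exp (- (\<nu> * ?V r))" if "0 < r" for r
    using prob_void_le[of "cball 0 r"] that
    by (simp add: p_def content_cball ball_volume_eq)
  have lower: "exp (- (\<nu> * (?V r * h r))) \<le> p r" if "0 < r" for r
    using prob_void_ball_ge[OF int, of r] that
    by (simp add: p_def h_def ball_volume_eq power_divide)
  \<comment> \<open>From this volume on, the upper bound on \<open>p r\<close> is at most
    \<open>1 / 2\<close>, the range in which the logarithmic estimates hold.\<close>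
  have "\<forall>\<^sub>F r in at_top. ln 2 / \<nu> \<le> ?V r"
    using V_lim by (simp add: filterlim_at_top)
  moreover have "\<forall>\<^sub>F r in at_top. 0 < ?V r"
    using V_lim by (simp add: filterlim_at_top_dense)
  ultimately have bounds: "\<forall>\<^sub>F r in at_top. - \<nu> * h r \<le> 1 / ?V r * ?L r \<and>
      1 / ?V r * ?L r \<le> ln 2 / ?V r - \<nu>"
    using eventually_gt_at_top[of 0]
  proof eventually_elim
    case (elim r)
    have "exp (- (\<nu> * ?V r)) \<le> exp (- ln 2)"
      using elim intensity_pos by (simp add: field_simps)
    then have half: "p r \<le> 1 / 2"
      using upper[of r] elim by (simp add: exp_minus)
    have pos: "0 < p r"
      using lower[of r] elim by (meson exp_gt_zero less_le_trans)
    have "- (\<nu> * (?V r * h r)) \<le> ln (p r)"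
      using lower[of r] elim pos by (simp add: ln_ge_iff)
    then have 1: "- (\<nu> * (?V r * h r)) \<le> ?L r"
      using ln_neg_ln_one_minus_bounds(1)[OF pos half]
      by (simp add: empty_space_function_def p_def)
    have "ln (p r) \<le> - (\<nu> * ?V r)"
      using upper[of r] elim pos by (metis ln_exp ln_le_cancel_iff exp_gt_zero)
    then have 2: "?L r \<le> ln 2 - \<nu> * ?V r"
      using ln_neg_ln_one_minus_bounds(2)[OF pos half]
      by (simp add: empty_space_function_def p_def)
    from 1 2 show ?case using elim by (simp add: field_simps)
  qed
  show ?thesis
  proof (rule tendsto_sandwich)
    show "((\<lambda>r. - \<nu> * h r) \<longlongrightarrow> - \<nu>) at_top"
      using tendsto_mult_left[OF relative_volume_limit[OF int], of "- \<nu>"] by (simp add: h_def)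
    have "((\<lambda>r. ln 2 / ?V r) \<longlongrightarrow> 0) at_top"
      by (intro tendsto_divide_0[OF tendsto_const] filterlim_at_top_imp_at_infinity V_lim)
    then show "((\<lambda>r. ln 2 / ?V r - \<nu>) \<longlongrightarrow> - \<nu>) at_top"
      using tendsto_diff[of _ 0 at_top "\<lambda>_. \<nu>" \<nu>] by simp
  qed (use bounds in \<open>auto elim: eventually_mono\<close>)
qed

end
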